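(* Let $A$ be a finite-dimensional $C^*$-algebra with $\mathbb{C}$-basis $(e_i)_i$ and structural constants $C^k_{ij}\in\mathbb{C}$, $e_ie_j=\sum_k C^k_{ij}e_k$, and write $C^k_{ij}=C^{k0}_{ij}+C^{k1}_{ij}\mathrm{i}$ with $C^{k0}_{ij},C^{k1}_{ij}\in\mathbb{R}$. Let the involution $x\mapsto x^*$ of $A$ be written in real coordinates as $$(x^* )^{0j}=\sum_i\left(f^{0j}_{0i}x^{0i}+f^{1j}_{0i}x^{1i}\right),\qquad (x^* )^{1j}=\sum_i\left(f^{1j}_{0i}x^{0i}-f^{0j}_{0i}x^{1i}\right),$$ with real numbers $f^{0j}_{0i},f^{1j}_{0i}$. Then for all $i,j,l$ $$\sum_k\left(C^{k0}_{ij}f^{0l}_{0k}+C^{k1}_{ij}f^{1l}_{0k}\right)=\sum_{p,q}\left(f^{0p}_{0j}f^{0q}_{0i}C^{l0}_{pq}-f^{1p}_{0j}f^{1q}_{0i}C^{l0}_{pq}-f^{0p}_{0j}f^{1q}_{0i}C^{l1}_{pq}-f^{1p}_{0j}f^{0q}_{0i}C^{l1}_{pq}\right),$$ $$\sum_k\left(C^{k0}_{ij}f^{1l}_{0k}-C^{k1}_{ij}f^{0l}_{0k}\right)=\sum_{p,q}\left(f^{0p}_{0j}f^{0q}_{0i}C^{l1}_{pq}-f^{1p}_{0j}f^{1q}_{0i}C^{l1}_{pq}+f^{0p}_{0j}f^{1q}_{0i}C^{l0}_{pq}+f^{1p}_{0j}f^{0q}_{0i}C^{l0}_{pq}\ri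ght).$$
   Context: A $C^*$-algebra $A$ is a Banach algebra over $\mathbb{C}$ endowed with an involution, i.e. an additive map $x\mapsto x^*$ of $A$ to itself such that $(cx)^*=\bar c\,x^*$ for $c\in\mathbb{C}$, $(xy)^*=y^*x^*$, $x^{**}=x$ and $\|x^*x\|=\|x\|^2$ for all $x,y\in A$. The real coordinates $x^{0i},x^{1i}\in\mathbb{R}$ of $x\in A$ with respect to the $\mathbb{C}$-basis $(e_i)$ are defined by $x=\sum_i(x^{0i}+x^{1i}\mathrm{i})e_i$, where $\mathrm{i}$ is the imaginary unit. Every antilinear self-map of $A$ can be written in the displayed coordinate form. *)

theory Defs
  imports Complex_Main
begin

text \<open>Complex Banach algebras, not assumed to be unital. Scalar multiplication by
  complex numbers extends the real one underlying the class \<^class>\<open>real_normed_algebra\<close>.\<close>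

class complex_banach_algebra = real_normed_algebra + banach +
  fixes scaleC :: "complex \<Rightarrow> 'a \<Rightarrow> 'a" (infixr "*\<^sub>C" 75)
  assumes scaleC_add_right: "c *\<^sub>C (x + y) = c *\<^sub>C x + c *\<^sub>C y"
    and scaleC_add_left: "(c + d) *\<^sub>C x = c *\<^sub>C x + d *\<^sub>C x"
    and scaleC_scaleC: "c *\<^sub>C d *\<^sub>C x = (c * d) *\<^sub>C x"
    and scaleC_of_real: "complex_of_real r *\<^sub>C x = r *\<^sub>R x"
    and mult_scaleC_left: "(c *\<^sub>C x) * y = c *\<^sub>C (x * y)"
    and mult_scaleC_right: "x * (c *\<^sub>C y) = c *\<^sub>C (x * y)"
    and norm_scaleC: "norm (c *\<^sub>C x) = cmod c * norm x"

class cstar_algebra = complex_banach_algebra +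
  fixes star :: "'a \<Rightarrow> 'a"
  assumes star_add: "star (x + y) = star x + star y"
    and star_scaleC: "star (c *\<^sub>C x) = cnj c *\<^sub>C star x"
    and star_mult: "star (x * y) = star y * star x"
    and star_star: "star (star x) = x"
    and norm_star_mult: "norm (star x * x) = (norm x)\<^sup>2"

global_interpretation complex_vector:
  vector_space "scaleC :: complex \<Rightarrow> 'a \<Rightarrow> 'a::complex_banach_algebra"
proof
  fix x :: 'a
  show "1 *\<^sub>C x = x"
    using scaleC_of_real[of 1 x] by simp
qed (simp_all add: scaleC_add_right scaleC_add_left scaleC_scaleC)

definition complex_basis :: "'i set \<Rightarrow> ('i \<Rightarrow> 'a::complex_banach_algebra) \<Rightarrow> bool" where
  "complex_basis I e \<longleftrightarrow> inj_on e I \<and> complex_vector.independent (e ` I)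
     \<and> complex_vector.span (e ` I) = UNIV"

text \<open>The real coordinates \<open>x\<^sup>0\<^sup>i\<close> and \<open>x\<^sup>1\<^sup>i\<close> are the real and imaginary parts of the
  complex coordinate of \<open>x\<close> at the basis vector \<open>e i\<close>.\<close>

definition coord0 :: "'i set \<Rightarrow> ('i \<Rightarrow> 'a::complex_banach_algebra) \<Rightarrow> 'a \<Rightarrow> 'i \<Rightarrow> real" where
  "coord0 I e x i = Re (complex_vector.representation (e ` I) x (e i))"

definition coord1 :: "'i set \<Rightarrow> ('i \<Rightarrow> 'a::complex_banach_algebra) \<Rightarrow> 'a \<Rightarrow> 'i \<Rightarrow> real" where
  "coord1 I e x i = Im (complex_vector.representation (e ` I) x (e i))"

lemma coord_expansion:
  fixes e :: "'i \<Rightarrow> 'a::complex_banach_algebra"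
  assumes "finite I" and "complex_basis I e"
  shows "x = (\<Sum>i\<in>I. (complex_of_real (coord0 I e x i) + complex_of_real (coord1 I e x i) * \<i>) *\<^sub>C e i)"
proof -
  have "(\<Sum>b\<in>e ` I. complex_vector.representation (e ` I) x b *\<^sub>C b) = x"
    using assms
    by (intro complex_vector.sum_representation_eq) (auto simp: complex_basis_def)
  moreover have "(\<Sum>b\<in>e ` I. complex_vector.representation (e ` I) x b *\<^sub>C b)
      = (\<Sum>i\<in>I. complex_vector.representation (e ` I) x (e i) *\<^sub>C e i)"
    using assms by (simp add: sum.reindex complex_basis_def)
  ultimately show ?thesis
    by (simp add: coord0_def coord1_def complex_eq[symmetric] mult.commute[of _ \<i>])
qed

end

theory Submission
  imports Defs
begin

text \<open>With \<open>F j i = f0 j i + \<i> * f1 j i\<close> the two coordinate formulas for the involution say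
  that the complex coordinates of \<open>star x\<close> are obtained by applying \<open>F\<close> to the conjugated
  coordinates of \<open>x\<close>. Comparing the \<open>l\<close>-th complex coordinates of both sides of
  \<open>star (e i * e j) = star (e j) * star (e i)\<close> gives
  \<open>(\<Sum>k. F l k * cnj (C k i j)) = (\<Sum>p. \<Sum>q. F p j * F q i * C l p q)\<close>, whose real and
  imaginary parts are the two identities.\<close>

lemma representation_combination:
  fixes e :: "'i \<Rightarrow> 'a::complex_banach_algebra"
  assumes "finite I" "complex_basis I e" "l \<in> I"
  shows "complex_vector.representation (e ` I) (\<Sum>k\<in>I. c k *\<^sub>C e k) (e l) = c l"
proof -
  have indep: "complex_vector.independent (e ` I)" and span: "complex_vector.span (e ` I) = UNIV"
    and inj: "inj_on e I"
    using assms(2) by (auto simp: complex_basis_def)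
  have "complex_vector.representation (e ` I) (\<Sum>k\<in>I. c k *\<^sub>C e k) (e l)
      = (\<Sum>k\<in>I. c k * complex_vector.representation (e ` I) (e k) (e l))"
    by (simp add: complex_vector.representation_sum[OF indep]
        complex_vector.representation_scale[OF indep] span)
  \<comment> \<open>The representation of a basis vector is an indicator on vectors; injectivity of
    \<open>e\<close> on \<open>I\<close> turns it into one on indices.\<close>
  also have "\<dots> = (\<Sum>k\<in>I. if k = l then c k else 0)"
    using assms(3) inj
    by (intro sum.cong) (auto simp: complex_vector.representation_basis[OF indep] inj_on_eq_iff)
  finally show ?thesis
    using assms(1,3) by simp
qed

lemma combination_unique:
  fixes e :: "'i \<Rightarrow> 'a::complex_banach_algebra"
  assumes "finite I" "complex_basis I e"
    and "(\<Sum>k\<in>I. c k *\<^sub>C e k) = (\<Sum>k\<in>I. d k *\<^sub>C e k)" "l \<in> I"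
  shows "c l = d l"
  using assms representation_combination by metis

lemma star_sum: "star (\<Sum>k\<in>I. g k) = (\<Sum>k\<in>I. star (g k :: 'a::cstar_algebra))"
proof -
  \<comment> \<open>This covers the empty sum and also infinite \<open>I\<close>, where the sum is 0
    by default.\<close>
  have "star (0::'a) = 0"
    using star_add[of "0::'a" 0] by simp
  then show ?thesis
    by (induction I rule: infinite_finite_induct) (auto simp: star_add)
qed

text \<open>With the images of the basis vectors under \<open>star\<close> given by a complex matrix
  \<open>F\<close>, the calculation stays over the complex numbers; real coordinates enter only when
  the resulting identity is split into parts.\<close>

lemma star_structural_constants:
  fixes e :: "'i \<Rightarrow> 'a::cstar_algebra"
  assumes fin: "finite I" and basis: "complex_basis I e"
    and mult_e: "\<And>i j. i \<in> I \<Longrightarrow> j \<in> I \<Longrightarrow> e i * e j = (\<Sum>k\<in>I. C k i j *\<^sub>C e k)"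
    and star_e: "\<And>i. i \<in> I \<Longrightarrow> star (e i) = (\<Sum>p\<in>I. F p i *\<^sub>C e p)"
    and ijl: "i \<in> I" "j \<in> I" "l \<in> I"
  shows "(\<Sum>k\<in>I. cnj (C k i j) * F l k) = (\<Sum>p\<in>I. \<Sum>q\<in>I. F p j * F q i * C l p q)"
proof -
  \<comment> \<open>The chain joins full expansions in the basis, with \<open>m\<close> running over
    all of \<open>I\<close>; the coefficient at \<open>l\<close> is extracted only at the
    end.\<close>
  have "(\<Sum>m\<in>I. (\<Sum>k\<in>I. cnj (C k i j) * F m k) *\<^sub>C e m)
      = (\<Sum>m\<in>I. \<Sum>k\<in>I. cnj (C k i j) *\<^sub>C F m k *\<^sub>C e m)"
    by (simp add: complex_vector.scale_sum_left scaleC_scaleC)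
  also have "\<dots> = (\<Sum>k\<in>I. cnj (C k i j) *\<^sub>C (\<Sum>m\<in>I. F m k *\<^sub>C e m))"
    by (subst sum.swap) (simp add: complex_vector.scale_sum_right)
  also have "\<dots> = (\<Sum>k\<in>I. cnj (C k i j) *\<^sub>C star (e k))"
    by (simp add: star_e)
  also have "\<dots> = star (e i * e j)"
    by (simp add: mult_e ijl star_sum star_scaleC)
  \<comment> \<open>\<open>star\<close> reverses the product, so the first index \<open>p\<close> is
    paired with \<open>j\<close> and the second index \<open>q\<close> with
    \<open>i\<close>.\<close>
  also have "\<dots> = (\<Sum>p\<in>I. \<Sum>q\<in>I. (F p j *\<^sub>C e p) * (F q i *\<^sub>C e q))"
    by (simp add: star_mult star_e ijl sum_product)
  also have "\<dots> = (\<Sum>p\<in>I. \<Sum>q\<in>I. \<Sum>m\<in>I. (F p j * F q i * C m p q) *\<^sub>C e m)"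
    by (simp add: mult_scaleC_left mult_scaleC_right mult_e complex_vector.scale_sum_right
        scaleC_scaleC mult_ac)
  also have "\<dots> = (\<Sum>p\<in>I. \<Sum>m\<in>I. \<Sum>q\<in>I. (F p j * F q i * C m p q) *\<^sub>C e m)"
    by (intro sum.cong refl sum.swap)
  also have "\<dots> = (\<Sum>m\<in>I. \<Sum>p\<in>I. \<Sum>q\<in>I. (F p j * F q i * C m p q) *\<^sub>C e m)"
    by (rule sum.swap)
  also have "\<dots> = (\<Sum>m\<in>I. (\<Sum>p\<in>I. \<Sum>q\<in>I. F p j * F q i * C m p q) *\<^sub>C e m)"
    by (simp add: complex_vector.scale_sum_left)
  finally show ?thesis
    \<comment> \<open>Giving \<open>c\<close> explicitly settles which occurrences of
      \<open>l\<close> are abstracted when \<open>c l\<close> is unified with the goal.\<close>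
    by (rule combination_unique[OF fin basis _ ijl(3),
        where c = "\<lambda>m. \<Sum>k\<in>I. cnj (C k i j) * F m k"])
qed

theorem theorem12p3:
  fixes I :: "'i set"
    and e :: "'i \<Rightarrow> 'a::cstar_algebra"
    and C :: "'i \<Rightarrow> 'i \<Rightarrow> 'i \<Rightarrow> complex"
    and C0 C1 :: "'i \<Rightarrow> 'i \<Rightarrow> 'i \<Rightarrow> real"
    and f0 f1 :: "'i \<Rightarrow> 'i \<Rightarrow> real"
    and i j l :: 'i
  assumes "finite I"
    and "complex_basis I e"
    and structural_constants:
      "\<And>i j. i \<in> I \<Longrightarrow> j \<in> I \<Longrightarrow> e i * e j = (\<Sum>k\<in>I. C k i j *\<^sub>C e k)"
    and "\<And>k i j. k \<in> I \<Longrightarrow> i \<in> I \<Longrightarrow> j \<in> I \<Longrightarrow>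
      C k i j = complex_of_real (C0 k i j) + complex_of_real (C1 k i j) * \<i>"
    and star_coord0: "\<And>x j. j \<in> I \<Longrightarrow>
      coord0 I e (star x) j = (\<Sum>i\<in>I. f0 j i * coord0 I e x i + f1 j i * coord1 I e x i)"
    and star_coord1: "\<And>x j. j \<in> I \<Longrightarrow>
      coord1 I e (star x) j = (\<Sum>i\<in>I. f1 j i * coord0 I e x i - f0 j i * coord1 I e x i)"
    and "i \<in> I" "j \<in> I" "l \<in> I"
  shows "(\<Sum>k\<in>I. C0 k i j * f0 l k + C1 k i j * f1 l k)
      = (\<Sum>p\<in>I. \<Sum>q\<in>I. f0 p j * f0 q i * C0 l p q - f1 p j * f1 q i * C0 l p q
          - f0 p j * f1 q i * C1 l p q - f1 p j * f0 q i * C1 l p q)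
    \<and> (\<Sum>k\<in>I. C0 k i j * f1 l k - C1 k i j * f0 l k)
      = (\<Sum>p\<in>I. \<Sum>q\<in>I. f0 p j * f0 q i * C1 l p q - f1 p j * f1 q i * C1 l p q
          + f0 p j * f1 q i * C0 l p q + f1 p j * f0 q i * C0 l p q)"
proof -
  define F where "F p i = Complex (f0 p i) (f1 p i)" for p i
  have star_e: "star (e i) = (\<Sum>p\<in>I. F p i *\<^sub>C e p)" if "i \<in> I" for i
  proof -
    have indep: "complex_vector.independent (e ` I)" and inj: "inj_on e I"
      using assms(2) by (auto simp: complex_basis_def)
    \<comment> \<open>Basis vectors have real coordinates, so the formulas for
      \<open>star (e i)\<close> collapse to the single entries \<open>f0 p i\<close> and
      \<open>f1 p i\<close>, the two parts of \<open>F p i\<close>.\<close>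
    have coord_e: "coord0 I e (e i) k = (if k = i then 1 else 0)" "coord1 I e (e i) k = 0"
      if "k \<in> I" for k
      using that \<open>i \<in> I\<close> inj
      by (auto simp: coord0_def coord1_def complex_vector.representation_basis[OF indep]
          inj_on_eq_iff)
    have "coord0 I e (star (e i)) p = f0 p i" "coord1 I e (star (e i)) p = f1 p i"
      if "p \<in> I" for p
      using that \<open>i \<in> I\<close> assms(1)
      by (simp_all add: star_coord0 star_coord1 coord_e if_distrib[of "times _"] cong: if_cong)
    then show ?thesis
      by (subst coord_expansion[OF assms(1,2), of "star (e i)"])
        (simp add: F_def Complex_eq mult.commute)
  qed
  have C_eq: "C k i j = Complex (C0 k i j) (C1 k i j)" if "k \<in> I" "i \<in> I" "j \<in> I" for k i j
    using assms(4)[OF that] by (simp add: Complex_eq mult.commute)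
  have eq: "(\<Sum>k\<in>I. cnj (Complex (C0 k i j) (C1 k i j)) * F l k)
      = (\<Sum>p\<in>I. \<Sum>q\<in>I. F p j * F q i * Complex (C0 l p q) (C1 l p q))"
    using star_structural_constants[OF assms(1,2) structural_constants star_e assms(7-9)]
    by (simp add: C_eq assms(7-9))
  show ?thesis
    \<comment> \<open>The conjugate on the left explains the signs there: plus in the real part,
      minus in the imaginary part. On the right, each part of a product of three complex numbers has
      four terms.\<close>
    using arg_cong[OF eq, of Re] arg_cong[OF eq, of Im]
    by (simp add: F_def algebra_simps)
qed

end
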